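(* Let $c \in (0, 1/2)$ and let $q$ be a nonnegative integer. For any randomized algorithm making at most $q$ cut queries, there is an undirected graph on $[n]$ with all edge weights in $\{0,1\}$ on which the probability that the algorithm estimates the max cut value within a factor of $c$ is at most $1 - \frac{n - 2^q}{2^{q+1}(n-1)}$.
   Context: Cut query model: an undirected graph on $[n]$ has non-negative edge weights $w_{i,j}$ and cut function $F(S) = \sum_{i \in S, j \notin S} w_{i,j}$; the algorithm accesses the graph only by submitting sets $S \subseteq [n]$ and receiving $F(S)$ (adaptively, with unlimited computation and internal randomness). With $\mathrm{OPT} = \max_S F(S)$, estimating the max cut value within a factor of $c$ means outputting a number $v$ with $c\cdot\mathrm{OPT} \le v \le \mathrm{OPT}$. *)

theory Defs
  imports "HOL-Probability.Probability"
begin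

text \<open>
  A graph on the vertex set \<open>{1..n}\<close> is given by its symmetric weight function;
  a weight of zero means that the edge is absent.  Values of \<open>w\<close> outside
  \<open>{1..n}\<close> are irrelevant.
\<close>

definition weighted_graph :: "nat \<Rightarrow> (nat \<Rightarrow> nat \<Rightarrow> real) \<Rightarrow> bool" where
  "weighted_graph n w \<longleftrightarrow>
     (\<forall>i\<in>{1..n}. w i i = 0 \<and> (\<forall>j\<in>{1..n}. w i j = w j i \<and> 0 \<le> w i j))"

definition cut_value :: "nat \<Rightarrow> (nat \<Rightarrow> nat \<Rightarrow> real) \<Rightarrow> nat set \<Rightarrow> real" where
  "cut_value n w S = (\<Sum>i\<in>S. \<Sum>j\<in>{1..n} - S. w i j)"

definition max_cut :: "nat \<Rightarrow> (nat \<Rightarrow> nat \<Rightarrow> real) \<Rightarrow> real" where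
  "max_cut n w = Max (cut_value n w ` Pow {1..n})"

definition estimates_within :: "real \<Rightarrow> real \<Rightarrow> real \<Rightarrow> bool" where
  "estimates_within c opt v \<longleftrightarrow> c * opt \<le> v \<and> v \<le> opt"

text \<open>
  A deterministic adaptive algorithm: either it stops with an output value, or it
  submits a set and continues in a way that depends on the answer received.
\<close>

datatype query_alg = Output real | Query "nat set" "real \<Rightarrow> query_alg"

primrec result :: "query_alg \<Rightarrow> (nat set \<Rightarrow> real) \<Rightarrow> real" where
  "result (Output v) F = v"
| "result (Query S k) F = result (k (F S)) F"

primrec queries :: "query_alg \<Rightarrow> (nat set \<Rightarrow> real) \<Rightarrow> nat set list" where
  "queries (Output v) F = []"
| "queries (Query S k) F = S # queries (k (F S)) F"

text \<open>
  The internal randomness is a seed \<open>\<omega>\<close> drawn from an arbitrary probability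
  space \<open>M\<close>; \<open>A \<omega>\<close> is the deterministic algorithm executed with that seed.
  The query bound holds for every seed, and measurability is only required of the output.
\<close>

definition randomized_cut_alg ::
    "nat \<Rightarrow> nat \<Rightarrow> 'r measure \<Rightarrow> ('r \<Rightarrow> query_alg) \<Rightarrow> bool" where
  "randomized_cut_alg n q M A \<longleftrightarrow> prob_space M \<and>
     (\<forall>w. weighted_graph n w \<longrightarrow>
        (\<lambda>\<omega>. result (A \<omega>) (cut_value n w)) \<in> borel_measurable M \<and>
        (\<forall>\<omega>\<in>space M. set (queries (A \<omega>) (cut_value n w)) \<subseteq> Pow {1..n} \<and>
                      length (queries (A \<omega>) (cut_value n w)) \<le> q))"

end

theory Submission
  imports Defs
begin

text \<open>
  Compare the empty graph with the graph that has one random edge \<open>{i, j}\<close>.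
  On the empty graph every answer is \<open>0\<close>, so a fixed seed produces a fixed list of at
  most \<open>q\<close> queries.  These split the vertices into at most \<open>2 ^ q\<close> classes, and by
  Cauchy--Schwarz a random pair lies inside one class with probability
  \<open>p \<ge> (n / 2 ^ q - 1) / (n - 1)\<close>.  On such a pair the algorithm gives the same output as on
  the empty graph, but the only correct output there is \<open>0\<close>, which is wrong once there
  is an edge.  So the success probabilities on the empty graph and on the random edge sum to
  at most \<open>2 - p\<close>, and one of the graphs has success probability at most \<open>1 - p / 2\<close>.
\<close>

text \<open>Agreement on the sets asked in the run on \<open>F\<close> suffices: equal answers keep
  the run on \<open>G\<close> on the same branch, so it asks the same sets in turn.\<close>

lemma result_cong_queries:
  assumes "\<And>S. S \<in> set (queries a F) \<Longrightarrow> F S = G S"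
  shows "result a F = result a G"
  using assms by (induction a) auto

section \<open>Counting pairs that a list of queries does not separate\<close>

lemma card_pairs_same_fibre_ge:
  fixes f :: "'a \<Rightarrow> 'b"
  assumes "finite V" "finite T" "f ` V \<subseteq> T"
  shows "(real (card V))\<^sup>2 \<le> real (card T) * real (card {(i, j) \<in> V \<times> V. f i = f j})"
proof -
  define C where "C t = {i \<in> V. f i = t}" for t
  have fin: "finite (C t)" for t
    using assms(1) by (simp add: C_def)
  have "V = (\<Union>t\<in>T. C t)"
    using assms(3) by (auto simp: C_def)
  then have "card V = card (\<Union>t\<in>T. C t)"
    by simp
  also have "\<dots> = (\<Sum>t\<in>T. card (C t))"
    using assms(2) fin by (intro card_UN_disjoint) (auto simp: C_def)
  finally have V: "real (card V) = (\<Sum>t\<in>T. real (card (C t)))"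
    by simp
  have "{(i, j) \<in> V \<times> V. f i = f j} = (\<Union>t\<in>T. C t \<times> C t)"
    using assms(3) by (auto simp: C_def)
  then have "card {(i, j) \<in> V \<times> V. f i = f j} = card (\<Union>t\<in>T. C t \<times> C t)"
    by simp
  also have "\<dots> = (\<Sum>t\<in>T. card (C t \<times> C t))"
    using assms(2) fin by (intro card_UN_disjoint) (auto simp: C_def)
  finally have "real (card {(i, j) \<in> V \<times> V. f i = f j}) = (\<Sum>t\<in>T. (real (card (C t)))\<^sup>2)"
    by (simp add: card_cartesian_product power2_eq_square)
  with V show ?thesis
    using sum_squared_le_sum_of_squares[of "\<lambda>t. real (card (C t))" T]
    by (simp add: mult.commute)
qed

text \<open>Ordered pairs keep the counting free of binomials. Every edge occurs twice, so a uniform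
  pair is still a uniform edge.\<close>

definition off_diagonal :: "'a set \<Rightarrow> ('a \<times> 'a) set" where
  "off_diagonal V = {(i, j) \<in> V \<times> V. i \<noteq> j}"

definition unseparated :: "'a set list \<Rightarrow> 'a \<Rightarrow> 'a \<Rightarrow> bool" where
  "unseparated Ss i j \<longleftrightarrow> (\<forall>S\<in>set Ss. i \<in> S \<longleftrightarrow> j \<in> S)"

lemma finite_off_diagonal [simp]: "finite V \<Longrightarrow> finite (off_diagonal V)"
  unfolding off_diagonal_def by (rule finite_subset[of _ "V \<times> V"]) auto

lemma card_off_diagonal:
  assumes "finite V"
  shows "real (card (off_diagonal V)) = real (card V) * (real (card V) - 1)"
proof -
  have "V \<times> V = off_diagonal V \<union> Id_on V"
    by (auto simp: off_diagonal_def Id_on_def)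
  then have "card (V \<times> V) = card (off_diagonal V \<union> Id_on V)"
    by simp
  also have "\<dots> = card (off_diagonal V) + card (Id_on V)"
    using assms by (intro card_Un_disjoint)
      (auto simp: off_diagonal_def Id_on_def intro: finite_subset[of _ "V \<times> V"])
  also have "card (Id_on V) = card V"
  proof -
    have "Id_on V = (\<lambda>i. (i, i)) ` V"
      by auto
    then show ?thesis
      by (simp add: card_image inj_on_def)
  qed
  finally have "real (card V * card V) = real (card (off_diagonal V)) + real (card V)"
    by (simp add: card_cartesian_product)
  then show ?thesis
    by (simp add: algebra_simps)
qed

text \<open>Label each vertex by the set of queries containing it. There are at most
  \<open>2 ^ q\<close> labels, so the fibre bound applies; the \<open>card V\<close> diagonal pairs
  are then subtracted. For \<open>card V < 2 ^ q\<close> the bound is negative or zero and says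
  nothing.\<close>

lemma card_unseparated_ge:
  assumes "finite V" "length Ss \<le> q"
  shows "real (card V) * (real (card V) - 2 ^ q) / 2 ^ q
           \<le> real (card {(i, j) \<in> off_diagonal V. unseparated Ss i j})"
    (is "_ \<le> real (card ?B)")
proof -
  define f where "f i = {S \<in> set Ss. i \<in> S}" for i
  let ?P = "{(i, j) \<in> V \<times> V. f i = f j}"
  have f_eq: "f i = f j \<longleftrightarrow> unseparated Ss i j" for i j
    by (auto simp: f_def unseparated_def)
  have fin: "finite ?B"
    by (rule finite_subset[of _ "V \<times> V"]) (use assms(1) in \<open>auto simp: off_diagonal_def\<close>)
  have "?P = ?B \<union> (\<lambda>i. (i, i)) ` V"
    by (auto simp: f_eq off_diagonal_def unseparated_def)
  then have "card ?P \<le> card ?B + card ((\<lambda>i. (i, i)) ` V)"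
    by (metis card_Un_le)
  also have "\<dots> \<le> card ?B + card V"
    using assms(1) by (simp add: card_image_le)
  finally have P: "real (card ?P) \<le> real (card ?B) + real (card V)"
    by linarith
  have "card (Pow (set Ss)) \<le> 2 ^ q"
    using card_length[of Ss] assms(2) by (auto simp: card_Pow intro!: power_increasing)
  then have Pow: "real (card (Pow (set Ss))) \<le> 2 ^ q"
    by (metis of_nat_le_iff of_nat_numeral of_nat_power)
  have "(real (card V))\<^sup>2 \<le> real (card (Pow (set Ss))) * real (card ?P)"
    using assms(1) by (intro card_pairs_same_fibre_ge) (auto simp: f_def)
  also have "\<dots> \<le> 2 ^ q * (real (card ?B) + real (card V))"
    using Pow P by (intro mult_mono) auto
  finally show ?thesis
    by (simp add: field_simps power2_eq_square)
qed

section \<open>The empty graph and the graphs with one edge\<close>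

definition single_edge :: "nat \<Rightarrow> nat \<Rightarrow> nat \<Rightarrow> nat \<Rightarrow> real" where
  "single_edge i j a b = (if a = i \<and> b = j \<or> a = j \<and> b = i then 1 else 0)"

lemma weighted_graph_single_edge: "i \<noteq> j \<Longrightarrow> weighted_graph n (single_edge i j)"
  by (auto simp: weighted_graph_def single_edge_def)

lemma cut_value_zero: "cut_value n (\<lambda>_ _. 0) S = 0"
  by (simp add: cut_value_def)

lemma max_cut_zero: "max_cut n (\<lambda>_ _. 0) = 0"
proof -
  have "cut_value n (\<lambda>_ _. 0) ` Pow {1..n} = {0}"
    by (auto simp: cut_value_zero)
  then show ?thesis
    by (simp add: max_cut_def)
qed

lemma cut_value_single_edge_unseparated:
  assumes "i \<in> S \<longleftrightarrow> j \<in> S"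
  shows "cut_value n (single_edge i j) S = 0"
  unfolding cut_value_def by (intro sum.neutral ballI) (use assms in \<open>auto simp: single_edge_def\<close>)

lemma max_cut_single_edge_pos:
  assumes "(i, j) \<in> off_diagonal {1..n}"
  shows "max_cut n (single_edge i j) > 0"
proof -
  have "0 < cut_value n (single_edge i j) {i}"
    using assms unfolding cut_value_def off_diagonal_def
    by (auto intro!: sum_pos2[of _ j] simp: single_edge_def)
  also have "\<dots> \<le> max_cut n (single_edge i j)"
    unfolding max_cut_def using assms by (intro Max_ge) (auto simp: off_diagonal_def)
  finally show ?thesis .
qed

lemma estimates_within_zero_iff: "estimates_within c 0 v \<longleftrightarrow> v = 0"
  by (auto simp: estimates_within_def)

abbreviation (input) succeeds :: "real \<Rightarrow> nat \<Rightarrow> query_alg \<Rightarrow> (nat \<Rightarrow> nat \<Rightarrow> real) \<Rightarrow> bool" where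
  "succeeds c n a w \<equiv> estimates_within c (max_cut n w) (result a (cut_value n w))"

lemma not_succeeds_single_edge_unseparated:
  assumes "0 < c" and ij: "(i, j) \<in> off_diagonal {1..n}"
    and unsep: "unseparated (queries a (cut_value n (\<lambda>_ _. 0))) i j"
    and "succeeds c n a (\<lambda>_ _. 0)"
  shows "\<not> succeeds c n a (single_edge i j)"
proof -
  have "result a (cut_value n (\<lambda>_ _. 0)) = result a (cut_value n (single_edge i j))"
    using unsep by (intro result_cong_queries)
      (simp add: cut_value_zero cut_value_single_edge_unseparated unseparated_def)
  then have "result a (cut_value n (single_edge i j)) = 0"
    using assms(4) by (simp add: max_cut_zero estimates_within_zero_iff)
  \<comment> \<open>Positivity of \<open>c\<close> rules out the output 0 here: it falls below the
    lower end of the admissible interval.\<close>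
  moreover have "c * max_cut n (single_edge i j) > 0"
    using assms(1) max_cut_single_edge_pos[OF ij] by simp
  ultimately show ?thesis
    by (simp add: estimates_within_def)
qed

text \<open>This is the inequality for one fixed seed. The empty graph gets weight
  \<open>n * (n - 1)\<close>, as much as all ordered pairs together.\<close>

lemma sum_successes_le:
  assumes "0 < c" "length (queries a (cut_value n (\<lambda>_ _. 0))) \<le> q"
  shows "real n * (real n - 1) * of_bool (succeeds c n a (\<lambda>_ _. 0))
           + (\<Sum>(i, j)\<in>off_diagonal {1..n}. of_bool (succeeds c n a (single_edge i j)))
         \<le> 2 * (real n * (real n - 1)) - real n * (real n - 2 ^ q) / 2 ^ q"
proof -
  let ?E = "off_diagonal {1..n}"
  let ?u = "unseparated (queries a (cut_value n (\<lambda>_ _. 0)))"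
  let ?G = "{(i, j) \<in> ?E. succeeds c n a (single_edge i j)}"
  let ?B = "{(i, j) \<in> ?E. ?u i j}"
  have card_E: "real (card ?E) = real n * (real n - 1)"
    by (simp add: card_off_diagonal)
  have B: "real n * (real n - 2 ^ q) / 2 ^ q \<le> real (card ?B)"
    using card_unseparated_ge[of "{1..n}", OF _ assms(2)] by simp
  have fin: "finite ?G" "finite ?B"
    by (rule finite_subset[of _ ?E]; auto)+
  have "(\<Sum>(i, j)\<in>?E. of_bool (succeeds c n a (single_edge i j)))
          = (\<Sum>p\<in>?E. of_bool (p \<in> ?G) :: real)"
    by (intro sum.cong) auto
  also have "\<dots> = real (card (?E \<inter> ?G))"
    by (subst sum_of_bool_eq) (simp_all add: Int_def)
  also have "?E \<inter> ?G = ?G"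
    by auto
  finally have sum_eq:
    "(\<Sum>(i, j)\<in>?E. of_bool (succeeds c n a (single_edge i j))) = real (card ?G)" .
  have le_E: "card ?G \<le> card ?E" "card ?B \<le> card ?E"
    by (rule card_mono; auto)+
  show ?thesis
  proof (cases "succeeds c n a (\<lambda>_ _. 0)")
    case True
    \<comment> \<open>A seed that is right on the empty graph fails on every unseparated
      pair.\<close>
    have "?G \<inter> ?B = {}"
      using not_succeeds_single_edge_unseparated[OF assms(1) _ _ True] by blast
    then have "card ?G + card ?B = card (?G \<union> ?B)"
      using fin by (simp add: card_Un_disjoint)
    also have "\<dots> \<le> card ?E"
      by (rule card_mono) auto
    finally have "real (card ?G) + real (card ?B) \<le> real (card ?E)"
      by linarith
    with True B card_E show ?thesis
      unfolding sum_eq by simp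
  next
    \<comment> \<open>The empty graph contributes 0 and the pairs at most \<open>card ?E\<close>.
      The right side is no smaller, since the subtracted term is at most \<open>card ?B\<close>,
      hence at most \<open>card ?E\<close>.\<close>
    case False
    with le_E B card_E show ?thesis
      unfolding sum_eq by simp
  qed
qed

section \<open>Averaging over the seed\<close>

theorem theoremC1:
  fixes c :: real and n q :: nat
    and M :: "'r measure" and A :: "'r \<Rightarrow> query_alg"
  assumes "0 < c" and "c < 1/2" and "2 \<le> n"
    and "randomized_cut_alg n q M A"
  shows "\<exists>w. weighted_graph n w \<and> (\<forall>i\<in>{1..n}. \<forall>j\<in>{1..n}. w i j \<in> {0, 1}) \<and>
           measure M {\<omega> \<in> space M.
              estimates_within c (max_cut n w) (result (A \<omega>) (cut_value n w))}
           \<le> 1 - (real n - 2 ^ q) / (2 ^ (q + 1) * (real n - 1))"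
proof (rule ccontr)
  interpret prob_space M
    using assms(4) by (simp add: randomized_cut_alg_def)
  let ?E = "off_diagonal {1..n}"
  let ?N = "real n * (real n - 1)"
  define \<beta> where "\<beta> = 1 - (real n - 2 ^ q) / (2 ^ (q + 1) * (real n - 1))"
  define X where "X w = {\<omega> \<in> space M. succeeds c n (A \<omega>) w}" for w
  assume contra: "\<not> ?thesis"
  have zero: "weighted_graph n (\<lambda>_ _. 0)"
    by (simp add: weighted_graph_def)
  have large_zero: "\<beta> < prob (X (\<lambda>_ _. 0))"
  proof (rule ccontr)
    assume "\<not> ?thesis"
    then show False
      using contra zero unfolding \<beta>_def X_def by (auto simp: not_less)
  qed
  have large_edge: "\<beta> < prob (X (single_edge i j))" if "(i, j) \<in> ?E" for i j
  proof (rule ccontr)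
    assume "\<not> ?thesis"
    moreover have "weighted_graph n (single_edge i j)"
      using that by (intro weighted_graph_single_edge) (auto simp: off_diagonal_def)
    moreover have "\<forall>a\<in>{1..n}. \<forall>b\<in>{1..n}. single_edge i j a b \<in> {0, 1}"
      by (simp add: single_edge_def)
    ultimately show False
      using contra unfolding \<beta>_def X_def by (meson not_less)
  qed
  have X_sets: "X w \<in> sets M" if "weighted_graph n w" for w
  proof -
    have [measurable]: "(\<lambda>\<omega>. result (A \<omega>) (cut_value n w)) \<in> borel_measurable M"
      using assms(4) that by (simp add: randomized_cut_alg_def)
    show ?thesis
      unfolding X_def estimates_within_def by measurable
  qed
  have int_zero: "integrable M (indicat_real (X (\<lambda>_ _. 0)))"
    using X_sets[OF zero] by (simp add: less_top[symmetric])
  have int_edge: "integrable M (indicat_real (X (single_edge (fst p) (snd p))))" if "p \<in> ?E" for p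
    using that by (auto simp: off_diagonal_def less_top[symmetric]
        intro!: X_sets weighted_graph_single_edge)
  \<comment> \<open>Integrating this weighted count of successes over the seed turns the bound for
    each seed into one on the success probabilities.\<close>
  let ?S = "\<lambda>\<omega>. ?N * indicator (X (\<lambda>_ _. 0)) \<omega>
              + (\<Sum>p\<in>?E. indicator (X (single_edge (fst p) (snd p))) \<omega>) :: real"
  have pointwise: "?S \<omega> \<le> 2 * ?N - real n * (real n - 2 ^ q) / 2 ^ q" if "\<omega> \<in> space M" for \<omega>
  proof -
    have "length (queries (A \<omega>) (cut_value n (\<lambda>_ _. 0))) \<le> q"
      using assms(4) that zero by (simp add: randomized_cut_alg_def)
    from sum_successes_le[OF assms(1) this] show ?thesis
      using that by (simp add: X_def indicator_def case_prod_beta of_bool_def)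
  qed
  have N: "?N > 0"
    using assms(3) by simp
  have "?N * prob (X (\<lambda>_ _. 0)) + (\<Sum>p\<in>?E. prob (X (single_edge (fst p) (snd p))))
          = (\<integral>\<omega>. ?S \<omega> \<partial>M)"
  proof -
    have "(\<integral>\<omega>. ?S \<omega> \<partial>M) = ?N * (\<integral>\<omega>. indicat_real (X (\<lambda>_ _. 0)) \<omega> \<partial>M)
        + (\<Sum>p\<in>?E. \<integral>\<omega>. indicat_real (X (single_edge (fst p) (snd p))) \<omega> \<partial>M)"
      using int_zero int_edge
      by (subst Bochner_Integration.integral_add)
        (auto simp: Bochner_Integration.integral_sum)
    moreover have "X w \<inter> space M = X w" for w
      by (auto simp: X_def)
    ultimately show ?thesis
      by simp
  qed
  also have "\<dots> \<le> (\<integral>\<omega>. 2 * ?N - real n * (real n - 2 ^ q) / 2 ^ q \<partial>M)"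
    using int_zero int_edge pointwise by (intro integral_mono) auto
  also have "\<dots> = 2 * ?N - real n * (real n - 2 ^ q) / 2 ^ q"
    by (simp add: prob_space)
  \<comment> \<open>The threshold \<beta> is the bound for one seed divided by the total weight
    \<open>2 * ?N\<close>; \<open>n \<ge> 2\<close> keeps this weight nonzero.\<close>
  also have "\<dots> = 2 * ?N * \<beta>"
    using assms(3) by (simp add: \<beta>_def field_simps)
  finally have upper: "?N * prob (X (\<lambda>_ _. 0))
      + (\<Sum>p\<in>?E. prob (X (single_edge (fst p) (snd p)))) \<le> 2 * ?N * \<beta>" .
  have "?N * \<beta> = (\<Sum>p\<in>?E. \<beta>)"
    by (simp add: card_off_diagonal)
  also have "\<dots> \<le> (\<Sum>p\<in>?E. prob (X (single_edge (fst p) (snd p))))"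
    by (intro sum_mono less_imp_le large_edge) auto
  finally have "?N * \<beta> \<le> (\<Sum>p\<in>?E. prob (X (single_edge (fst p) (snd p))))" .
  \<comment> \<open>The strict inequality comes from the empty graph, so the sum over the edges may
    be bounded weakly.\<close>
  moreover have "?N * \<beta> < ?N * prob (X (\<lambda>_ _. 0))"
    using N large_zero by (rule mult_strict_left_mono[rotated])
  ultimately show False
    using upper by linarith
qed

end
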